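(* Let $H=\{\mathrm{A},\mathrm{B},\mathrm{C},\mathrm{D},\mathrm{9}\}$ be Huntington's set of five axioms for a ternary relation (listed in the context). For each of the $32$ subsets $X\subseteq H$, let $m(X)$ be the least cardinality of a structure in which every axiom in $H\setminus X$ is true and every axiom in $X$ is false. Then $m(X)$ is defined for every $X\subseteq H$ (that is, such a structure exists, so $H$ is completely independent), and $m(X)\le 4$ for every $X$. There are exactly $11$ subsets $X$ with $m(X)<4$, and they and their minimal cardinalities are: \begin{itemize} \item $m(\emptyset)=1$; \item $m(\{\mathrm{D}\})=1$; \item $m(\{\mathrm{C}\})=3$; \item $m(\{\mathrm{C},\mathrm{D}\})=3$; \item $m(\{\mathrm{B}\})=3$; \item $m(\{\mathrm{B},\mathrm{D}\})=3$; \item $m(\{\mathrm{A}\})=3$; \item $m(\{\mathrm{A},\mathrm{D}\})=2$; \item $m(\{\mathrm{A},\mathrm{C}\})=3$; \item $m(\{\mathrm{A},\mathrm{C},\mathrm{D}\})=3$; \item $m(\{\mathrm{A},\mathrm{B},\mathrm{D}\})=3$. \end{itemize} For each of the remaining $21$ subsets $X$ of $H$, $m(X)=4$.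
   Context: The language is one-sorted first-order logic with equality and a single ternary relation symbol $\mathrm{B}(\cdot,\cdot,\cdot)$ ("betweenness"; this relation symbol is not to be confused with the axiom named $\mathrm{B}$). A structure is a nonempty set together with a ternary relation on it. For a sequence of variables, $\delta(x_1,\dots,x_n)$ abbreviates the conjunction asserting that $x_1,\dots,x_n$ are pairwise distinct. The axioms are the universal closures of the following formulas. Axiom $\mathrm{A}$: $\mathrm{B}(a,b,c)\rightarrow \mathrm{B}(c,b,a)$. Axiom $\mathrm{B}$: $\delta(a,b,c)\rightarrow\bigl(\mathrm{B}(b,a,c)\vee \mathrm{B}(c,a,b)\vee \mathrm{B}(a,b,c)\vee \mathrm{B}(c,b,a)\vee \mathrm{B}(a,c,b)\vee \mathrm{B}(b,c,a)\bigr)$. Axiom $\mathrm{C}$: $\delta(a,x,y)\rightarrow\neg\bigl(\mathrm{B}(a,x,y)\wedge \mathrm{B}(a,y,x)\bigr)$. Axiom $\mathrm{D}$: $\mathrm{B}(a,b,c)\rightarrow\delta(a,b,c)$. Axiom $\mathrm{9}$: $\bigl(\mathrm{B}(a,b,c)\wedge\delta(a,b,c,x)\bigr)\rightarrow\bigl(\mathrm{B}(a,b,x)\vee \mathrm{B}(x,b,c)\bigr)$. A set $S$ of sentences is completely independent if for every subset $X\subseteq S$ the set $(S\setminus X)\cup\{\neg\varphi\mid\varphi\in X\}$ is satisfiable. An axiom is false in a structure when its universal closure fails there. *)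

theory Defs
  imports Main "HOL-Library.Extended_Nat" "HOL-Library.Infinite_Typeclass"
begin

section \<open>First-order logic with equality and one ternary relation symbol\<close>

type_synonym var = nat

datatype form =
    Eq var var
  | Btw var var var
  | Neg form
  | And form form
  | Or form form
  | Imp form form
  | All var form

primrec free_vars :: "form \<Rightarrow> var set" where
  "free_vars (Eq u v) = {u, v}"
| "free_vars (Btw u v w) = {u, v, w}"
| "free_vars (Neg p) = free_vars p"
| "free_vars (And p q) = free_vars p \<union> free_vars q"
| "free_vars (Or p q) = free_vars p \<union> free_vars q"
| "free_vars (Imp p q) = free_vars p \<union> free_vars q"
| "free_vars (All u p) = free_vars p - {u}"

definition sentence :: "form \<Rightarrow> bool" where
  "sentence p \<longleftrightarrow> free_vars p = {}"

record 'a struct =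
  Dom :: "'a set"
  Rel :: "('a \<times> 'a \<times> 'a) set"

definition is_struct :: "'a struct \<Rightarrow> bool" where
  "is_struct S \<longleftrightarrow> Dom S \<noteq> {} \<and> Rel S \<subseteq> Dom S \<times> Dom S \<times> Dom S"

primrec sat :: "'a struct \<Rightarrow> (var \<Rightarrow> 'a) \<Rightarrow> form \<Rightarrow> bool" where
  "sat S e (Eq u v) \<longleftrightarrow> e u = e v"
| "sat S e (Btw u v w) \<longleftrightarrow> (e u, e v, e w) \<in> Rel S"
| "sat S e (Neg p) \<longleftrightarrow> \<not> sat S e p"
| "sat S e (And p q) \<longleftrightarrow> sat S e p \<and> sat S e q"
| "sat S e (Or p q) \<longleftrightarrow> sat S e p \<or> sat S e q"
| "sat S e (Imp p q) \<longleftrightarrow> (sat S e p \<longrightarrow> sat S e q)"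
| "sat S e (All u p) \<longleftrightarrow> (\<forall>d \<in> Dom S. sat S (e(u := d)) p)"

definition holds :: "'a struct \<Rightarrow> form \<Rightarrow> bool" where
  "holds S p \<longleftrightarrow> (\<forall>e. range e \<subseteq> Dom S \<longrightarrow> sat S e p)"

text \<open>HOL cannot quantify over types inside a formula, so the type \<open>'a\<close> from which the
  elements of structures are drawn is passed as an explicit argument. It is meant to be infinite:
  by the Loewenheim-Skolem theorem every satisfiable set of sentences then has a model over
  \<open>'a\<close>, and every structure over any type has an isomorphic copy over some infinite type.\<close>

definition satisfiable :: "'a itself \<Rightarrow> form set \<Rightarrow> bool" where
  "satisfiable ty T \<longleftrightarrow> (\<exists>S :: 'a struct. is_struct S \<and> (\<forall>p \<in> T. holds S p))"

definition completely_independent :: "'a itself \<Rightarrow> form set \<Rightarrow> bool" where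
  "completely_independent ty T \<longleftrightarrow>
     (\<forall>p \<in> T. sentence p) \<and> (\<forall>X. X \<subseteq> T \<longrightarrow> satisfiable ty ((T - X) \<union> Neg ` X))"

section \<open>Huntington's axioms\<close>

abbreviation (input) va :: var where "va \<equiv> 0"
abbreviation (input) vb :: var where "vb \<equiv> 1"
abbreviation (input) vc :: var where "vc \<equiv> 2"
abbreviation (input) vx :: var where "vx \<equiv> 3"
abbreviation (input) vy :: var where "vy \<equiv> 4"

definition delta3 :: "var \<Rightarrow> var \<Rightarrow> var \<Rightarrow> form" where
  "delta3 u v w = And (Neg (Eq u v)) (And (Neg (Eq u w)) (Neg (Eq v w)))"

definition delta4 :: "var \<Rightarrow> var \<Rightarrow> var \<Rightarrow> var \<Rightarrow> form" where
  "delta4 u v w z =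
     And (delta3 u v w) (And (Neg (Eq u z)) (And (Neg (Eq v z)) (Neg (Eq w z))))"

definition axA :: form where
  "axA = All va (All vb (All vc (Imp (Btw va vb vc) (Btw vc vb va))))"

definition axB :: form where
  "axB = All va (All vb (All vc (Imp (delta3 va vb vc)
     (Or (Btw vb va vc) (Or (Btw vc va vb) (Or (Btw va vb vc)
     (Or (Btw vc vb va) (Or (Btw va vc vb) (Btw vb vc va)))))))))"

definition axC :: form where
  "axC = All va (All vx (All vy (Imp (delta3 va vx vy)
     (Neg (And (Btw va vx vy) (Btw va vy vx))))))"

definition axD :: form where
  "axD = All va (All vb (All vc (Imp (Btw va vb vc) (delta3 va vb vc))))"

definition ax9 :: form where
  "ax9 = All va (All vb (All vc (All vx (Imp (And (Btw va vb vc) (delta4 va vb vc vx))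
     (Or (Btw va vb vx) (Btw vx vb vc))))))"

definition Huntington :: "form set" where
  "Huntington = {axA, axB, axC, axD, ax9}"

section \<open>Minimal cardinalities\<close>

definition realizes :: "'a struct \<Rightarrow> form set \<Rightarrow> bool" where
  "realizes S X \<longleftrightarrow> is_struct S \<and>
     (\<forall>p \<in> Huntington - X. holds S p) \<and> (\<forall>p \<in> X. \<not> holds S p)"

definition struct_card :: "'a struct \<Rightarrow> enat" where
  "struct_card S = (if finite (Dom S) then enat (card (Dom S)) else \<infinity>)"

text \<open>All infinite cardinalities are identified with \<open>\<infinity>\<close>, and \<open>\<infinity>\<close> is also the value when no
  structure realizes \<open>X\<close>; a finite value is the exact least cardinality and is attained.\<close>

definition min_card :: "'a itself \<Rightarrow> form set \<Rightarrow> enat" where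
  "min_card ty X = (INF S \<in> {S :: 'a struct. realizes S X}. struct_card S)"

end

theory Submission
  imports Defs
begin

text \<open>A false axiom exhibits a certain number of distinct points, and the minimal
  cardinalities are dictated by how these configurations can overlap.

  Lower bounds. A failure of \<open>ax9\<close> exhibits four distinct points. A failure of \<open>axB\<close> exhibits
  an unordered triple of points on which \<open>B\<close> never holds, whereas a failure of \<open>axC\<close>, or of
  \<open>axA\<close> when \<open>axD\<close> is true, exhibits a triple on which it sometimes holds; these are two
  different triples, so both together need a fourth point. A single failure of one of these
  kinds still needs three points, and a failure of \<open>axA\<close> alone, which may be a degenerate triple
  such as \<open>B(p,p,q)\<close>, needs two.

  Upper bounds. These bounds (collected in \<open>bound\<close>) are attained by initial segments of the
  natural numbers. Truth of \<open>axB\<close>, \<open>axC\<close> and \<open>ax9\<close> depends only on the nondegenerate triples,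
  so eight lists of such triples settle these three axioms. They can be chosen so that
  closing under reversal \<open>(p,q,r) \<mapsto> (r,q,p)\<close>
  changes at most \<open>axA\<close>, from false to true. One degenerate triple makes
  \<open>axD\<close> false: \<open>(0,0,0)\<close> if \<open>axA\<close> is to stay true and \<open>(0,0,1)\<close> if it is to become
  false. The \<open>32\<close> resulting finite structures are checked by
  computation (\<open>model_correct\<close>), and an injection of the natural numbers into the given
  infinite type carries them over (\<open>holds_copy\<close>).

  Together these facts give the formula \<open>min_card_eq_bound\<close>, from which everything else is read off
  by running through the subsets of \<open>Huntington\<close>.\<close>

section \<open>Truth of formulas\<close>

lemma sat_cong:
  assumes "\<And>v. v \<in> free_vars p \<Longrightarrow> e v = e' v"
  shows "sat S e p = sat S e' p"
  using assms
proof (induction p arbitrary: e e')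
  case (All u p)
  have "sat S (e(u := d)) p = sat S (e'(u := d)) p" for d
    by (rule All.IH) (use All.prems in auto)
  then show ?case by simp
next
  case (Neg p)
  then show ?case by (metis free_vars.simps(3) sat.simps(3))
next
  case (And p q)
  have "sat S e p = sat S e' p" "sat S e q = sat S e' q"
    by (rule And.IH; use And.prems in auto)+
  then show ?case by simp
next
  case (Or p q)
  have "sat S e p = sat S e' p" "sat S e q = sat S e' q"
    by (rule Or.IH; use Or.prems in auto)+
  then show ?case by simp
next
  case (Imp p q)
  have "sat S e p = sat S e' p" "sat S e q = sat S e' q"
    by (rule Imp.IH; use Imp.prems in auto)+
  then show ?case by simp
qed auto

text \<open>Being a sentence matters: \<open>holds\<close> speaks of the universal closure, so an open
  formula and its negation may both fail to hold. Complete independence asks for the negated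
  axiom to hold, minimal cardinalities for the axiom not to hold.\<close>

lemma holds_Neg_iff:
  assumes "is_struct S" "sentence p"
  shows "holds S (Neg p) \<longleftrightarrow> \<not> holds S p"
proof -
  obtain s where "s \<in> Dom S" using assms(1) by (auto simp: is_struct_def)
  then have ex: "range (\<lambda>_::var. s) \<subseteq> Dom S" by auto
  have "sat S e p = sat S e' p" for e e'
    by (rule sat_cong) (use assms(2) in \<open>auto simp: sentence_def\<close>)
  then show ?thesis unfolding holds_def using ex by (metis sat.simps(3))
qed

definition copy :: "('a \<Rightarrow> 'b) \<Rightarrow> 'a struct \<Rightarrow> 'b struct" where
  "copy f S = \<lparr>Dom = f ` Dom S, Rel = (\<lambda>(x, y, z). (f x, f y, f z)) ` Rel S\<rparr>"

lemma sat_copy: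
  assumes "inj f"
  shows "sat (copy f S) (f \<circ> e) p = sat S e p"
proof (induction p arbitrary: e)
  case (Eq u v)
  then show ?case using assms by (auto simp: inj_eq)
next
  case (Btw u v w)
  then show ?case using assms by (force simp: copy_def inj_eq)
next
  case (All u p)
  have "sat (copy f S) ((f \<circ> e)(u := f d)) p = sat S (e(u := d)) p" for d
    using All.IH[of "e(u := d)"] by (simp only: fun_upd_comp)
  moreover have "Dom (copy f S) = f ` Dom S" by (simp add: copy_def)
  ultimately show ?case by (simp del: o_apply)
qed auto

lemma holds_copy:
  assumes "inj f"
  shows "holds (copy f S) p \<longleftrightarrow> holds S p"
proof
  assume *: "holds (copy f S) p"
  show "holds S p" unfolding holds_def
  proof (intro allI impI)
    fix e :: "var \<Rightarrow> 'a" assume "range e \<subseteq> Dom S"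
    then have "range (f \<circ> e) \<subseteq> Dom (copy f S)" by (auto simp: copy_def)
    then show "sat S e p" using * sat_copy[OF assms] unfolding holds_def by blast
  qed
next
  assume *: "holds S p"
  show "holds (copy f S) p" unfolding holds_def
  proof (intro allI impI)
    fix e :: "var \<Rightarrow> 'b" assume e: "range e \<subseteq> Dom (copy f S)"
    define e' where "e' = inv f \<circ> e"
    have "e v \<in> f ` Dom S" for v using e by (auto simp: copy_def)
    then have "f (e' v) = e v \<and> e' v \<in> Dom S" for v
      unfolding e'_def using assms by (metis comp_apply image_iff inv_f_f)
    then have "e = f \<circ> e'" "range e' \<subseteq> Dom S" by auto
    then show "sat (copy f S) e p" using * sat_copy[OF assms] unfolding holds_def by metis
  qed
qed

lemma is_struct_copy: "is_struct S \<Longrightarrow> is_struct (copy f S)"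
  unfolding is_struct_def copy_def by fastforce

lemma struct_card_copy: "inj f \<Longrightarrow> struct_card (copy f S) = struct_card S"
  by (auto simp: struct_card_def copy_def card_image finite_image_iff inj_on_subset)

section \<open>The five axioms\<close>

lemma holds_closed:
  assumes "is_struct S" and "\<And>e. sat S e p \<longleftrightarrow> Q"
  shows "holds S p \<longleftrightarrow> Q"
proof -
  obtain s where "s \<in> Dom S" using assms(1) by (auto simp: is_struct_def)
  then have "range (\<lambda>_::var. s) \<subseteq> Dom S" by auto
  then show ?thesis unfolding holds_def using assms(2) by blast
qed

lemma holds_axA:
  assumes "is_struct S"
  shows "holds S axA \<longleftrightarrow>
    (\<forall>a\<in>Dom S. \<forall>b\<in>Dom S. \<forall>c\<in>Dom S. (a, b, c) \<in> Rel S \<longrightarrow> (c, b, a) \<in> Rel S)"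
  by (rule holds_closed[OF assms]) (simp add: axA_def)

lemma holds_axB:
  assumes "is_struct S"
  shows "holds S axB \<longleftrightarrow>
    (\<forall>a\<in>Dom S. \<forall>b\<in>Dom S. \<forall>c\<in>Dom S. a \<noteq> b \<and> a \<noteq> c \<and> b \<noteq> c \<longrightarrow>
      (b, a, c) \<in> Rel S \<or> (c, a, b) \<in> Rel S \<or> (a, b, c) \<in> Rel S \<or>
      (c, b, a) \<in> Rel S \<or> (a, c, b) \<in> Rel S \<or> (b, c, a) \<in> Rel S)"
  by (rule holds_closed[OF assms]) (simp add: axB_def delta3_def)

lemma holds_axC:
  assumes "is_struct S"
  shows "holds S axC \<longleftrightarrow>
    (\<forall>a\<in>Dom S. \<forall>x\<in>Dom S. \<forall>y\<in>Dom S. a \<noteq> x \<and> a \<noteq> y \<and> x \<noteq> y \<longrightarrow>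
      \<not> ((a, x, y) \<in> Rel S \<and> (a, y, x) \<in> Rel S))"
  by (rule holds_closed[OF assms]) (simp add: axC_def delta3_def)

lemma holds_axD:
  assumes "is_struct S"
  shows "holds S axD \<longleftrightarrow>
    (\<forall>a\<in>Dom S. \<forall>b\<in>Dom S. \<forall>c\<in>Dom S. (a, b, c) \<in> Rel S \<longrightarrow>
      a \<noteq> b \<and> a \<noteq> c \<and> b \<noteq> c)"
  by (rule holds_closed[OF assms]) (simp add: axD_def delta3_def)

lemma holds_ax9:
  assumes "is_struct S"
  shows "holds S ax9 \<longleftrightarrow>
    (\<forall>a\<in>Dom S. \<forall>b\<in>Dom S. \<forall>c\<in>Dom S. \<forall>x\<in>Dom S.
      (a, b, c) \<in> Rel S \<and> (a \<noteq> b \<and> a \<noteq> c \<and> b \<noteq> c) \<and> a \<noteq> x \<and> b \<noteq> x \<and> c \<noteq> x \<longrightarrow>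
      (a, b, x) \<in> Rel S \<or> (x, b, c) \<in> Rel S)"
  by (rule holds_closed[OF assms]) (simp add: ax9_def delta3_def delta4_def)

lemmas holds_axioms = holds_axA holds_axB holds_axC holds_axD holds_ax9

lemma sentence_Huntington: "p \<in> Huntington \<Longrightarrow> sentence p"
  by (auto simp: Huntington_def sentence_def axA_def axB_def axC_def axD_def ax9_def
      delta3_def delta4_def)

lemma axioms_distinct: "distinct [axA, axB, axC, axD, ax9]"
  by (simp add: axA_def axB_def axC_def axD_def ax9_def delta3_def)

lemma axioms_neq [simp]:
  "axA \<noteq> axB" "axA \<noteq> axC" "axA \<noteq> axD" "axA \<noteq> ax9"
  "axB \<noteq> axA" "axB \<noteq> axC" "axB \<noteq> axD" "axB \<noteq> ax9"
  "axC \<noteq> axA" "axC \<noteq> axB" "axC \<noteq> axD" "axC \<noteq> ax9"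
  "axD \<noteq> axA" "axD \<noteq> axB" "axD \<noteq> axC" "axD \<noteq> ax9"
  "ax9 \<noteq> axA" "ax9 \<noteq> axB" "ax9 \<noteq> axC" "ax9 \<noteq> axD"
  using axioms_distinct by auto

lemma realizes_iff:
  assumes "X \<subseteq> Huntington"
  shows "realizes S X \<longleftrightarrow> is_struct S \<and>
    (holds S axA \<longleftrightarrow> axA \<notin> X) \<and> (holds S axB \<longleftrightarrow> axB \<notin> X) \<and> (holds S axC \<longleftrightarrow> axC \<notin> X) \<and>
    (holds S axD \<longleftrightarrow> axD \<notin> X) \<and> (holds S ax9 \<longleftrightarrow> ax9 \<notin> X)"
  using assms unfolding realizes_def Huntington_def by blast

section \<open>Lower bounds\<close>

text \<open>The five arguments say which of \<open>axA\<close>, \<open>axB\<close>, \<open>axC\<close>, \<open>axD\<close>, \<open>ax9\<close>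
  are to be false.\<close>

definition bound :: "bool \<Rightarrow> bool \<Rightarrow> bool \<Rightarrow> bool \<Rightarrow> bool \<Rightarrow> nat" where
  "bound fA fB fC fD f9 =
    (if f9 \<or> (fB \<and> (fC \<or> fA \<and> \<not> fD)) then 4
     else if fB \<or> fC \<or> (fA \<and> \<not> fD) then 3
     else if fA then 2 else 1)"

abbreviation bound_of :: "form set \<Rightarrow> nat" where
  "bound_of X \<equiv> bound (axA \<in> X) (axB \<in> X) (axC \<in> X) (axD \<in> X) (ax9 \<in> X)"

lemma card_le_struct_card:
  assumes "F \<subseteq> Dom S" "card F = n"
  shows "enat n \<le> struct_card S"
  using assms by (auto simp: struct_card_def card_mono)

text \<open>Three points carry only one unordered triple, which cannot both meet and avoid the
  relation.\<close>

lemma four_le_struct_card: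
  assumes abc: "(a, b, c) \<in> Rel S" "a \<in> Dom S" "b \<in> Dom S" "c \<in> Dom S"
      "a \<noteq> b" "a \<noteq> c" "b \<noteq> c"
    and uvw: "u \<in> Dom S" "v \<in> Dom S" "w \<in> Dom S" "u \<noteq> v" "u \<noteq> w" "v \<noteq> w"
    and avoid: "(v, u, w) \<notin> Rel S" "(w, u, v) \<notin> Rel S" "(u, v, w) \<notin> Rel S"
      "(w, v, u) \<notin> Rel S" "(u, w, v) \<notin> Rel S" "(v, w, u) \<notin> Rel S"
  shows "enat 4 \<le> struct_card S"
proof -
  have "\<exists>z\<in>{u, v, w}. z \<notin> {a, b, c}"
  proof (rule ccontr)
    assume "\<not> ?thesis"
    then have "u \<in> {a, b, c}" "v \<in> {a, b, c}" "w \<in> {a, b, c}" by auto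
    then show False using abc(1) uvw(4-6) avoid by auto
  qed
  then obtain z where z: "z \<in> Dom S" "z \<notin> {a, b, c}" using uvw by blast
  have "card {a, b, c, z} = 4" using z abc by auto
  then show ?thesis
    using card_le_struct_card[of "{a, b, c, z}" S 4] z abc by simp
qed

lemma not_axB_triple:
  assumes "is_struct S" "\<not> holds S axB"
  obtains u v w where "u \<in> Dom S" "v \<in> Dom S" "w \<in> Dom S" "u \<noteq> v" "u \<noteq> w" "v \<noteq> w"
    "(v, u, w) \<notin> Rel S" "(w, u, v) \<notin> Rel S" "(u, v, w) \<notin> Rel S"
    "(w, v, u) \<notin> Rel S" "(u, w, v) \<notin> Rel S" "(v, w, u) \<notin> Rel S"
proof -
  have "\<exists>u\<in>Dom S. \<exists>v\<in>Dom S. \<exists>w\<in>Dom S. (u \<noteq> v \<and> u \<noteq> w \<and> v \<noteq> w) \<and>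
    (v, u, w) \<notin> Rel S \<and> (w, u, v) \<notin> Rel S \<and> (u, v, w) \<notin> Rel S \<and>
    (w, v, u) \<notin> Rel S \<and> (u, w, v) \<notin> Rel S \<and> (v, w, u) \<notin> Rel S"
    using assms(2) unfolding holds_axB[OF assms(1)]
    by (simp only: not_imp de_Morgan_disj ball_simps bex_simps)
  then show ?thesis using that by auto
qed

text \<open>A failure of \<open>axA\<close> may come from a degenerate triple; it is \<open>axD\<close> that excludes this.\<close>

lemma related_triple:
  assumes "is_struct S" "\<not> holds S axC \<or> (\<not> holds S axA \<and> holds S axD)"
  obtains a b c where "(a, b, c) \<in> Rel S" "a \<in> Dom S" "b \<in> Dom S" "c \<in> Dom S"
    "a \<noteq> b" "a \<noteq> c" "b \<noteq> c"
proof -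
  from assms(2)
  have "\<exists>a\<in>Dom S. \<exists>b\<in>Dom S. \<exists>c\<in>Dom S. (a, b, c) \<in> Rel S \<and> a \<noteq> b \<and> a \<noteq> c \<and> b \<noteq> c"
  proof
    assume "\<not> holds S axC"
    then show ?thesis unfolding holds_axC[OF assms(1)] by blast
  next
    assume "\<not> holds S axA \<and> holds S axD"
    then show ?thesis unfolding holds_axA[OF assms(1)] holds_axD[OF assms(1)] by blast
  qed
  then show ?thesis using that by blast
qed

lemma bound_le_struct_card:
  assumes "realizes S X" "X \<subseteq> Huntington"
  shows "enat (bound_of X) \<le> struct_card S"
proof -
  have S: "is_struct S" and A: "holds S axA \<longleftrightarrow> axA \<notin> X" and B: "holds S axB \<longleftrightarrow> axB \<notin> X"
    and C: "holds S axC \<longleftrightarrow> axC \<notin> X" and D: "holds S axD \<longleftrightarrow> axD \<notin> X"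
    and N: "holds S ax9 \<longleftrightarrow> ax9 \<notin> X"
    using assms(1) unfolding realizes_iff[OF assms(2)] by simp_all
  have one: "enat 1 \<le> struct_card S"
  proof -
    obtain s where "s \<in> Dom S" using S by (auto simp: is_struct_def)
    then show ?thesis using card_le_struct_card[of "{s}" S 1] by simp
  qed
  have two: "enat 2 \<le> struct_card S" if "axA \<in> X"
  proof -
    have "\<not> holds S axA" using that A by simp
    then obtain a b c where "a \<in> Dom S" "c \<in> Dom S" "(a, b, c) \<in> Rel S" "(c, b, a) \<notin> Rel S"
      unfolding holds_axA[OF S] by blast
    moreover from this have "a \<noteq> c" by auto
    ultimately show ?thesis
      using card_le_struct_card[of "{a, c}" S 2] by simp
  qed
  have three: "enat 3 \<le> struct_card S" if "axB \<in> X \<or> axC \<in> X \<or> (axA \<in> X \<and> axD \<notin> X)"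
  proof -
    have "\<not> holds S axB \<or> (\<not> holds S axC \<or> (\<not> holds S axA \<and> holds S axD))"
      using that A B C D by blast
    then obtain a b c where "a \<in> Dom S" "b \<in> Dom S" "c \<in> Dom S" "a \<noteq> b" "a \<noteq> c" "b \<noteq> c"
    proof
      assume "\<not> holds S axB"
      then show thesis by (rule not_axB_triple[OF S]) (rule that)
    next
      assume "\<not> holds S axC \<or> (\<not> holds S axA \<and> holds S axD)"
      then show thesis by (rule related_triple[OF S]) (rule that)
    qed
    then show ?thesis
      using card_le_struct_card[of "{a, b, c}" S 3] by simp
  qed
  have four: "enat 4 \<le> struct_card S" if "axB \<in> X" "axC \<in> X \<or> (axA \<in> X \<and> axD \<notin> X)"
  proof -
    have "\<not> holds S axC \<or> (\<not> holds S axA \<and> holds S axD)"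
      using that(2) A C D by blast
    then obtain a b c where "(a, b, c) \<in> Rel S" "a \<in> Dom S" "b \<in> Dom S" "c \<in> Dom S"
      "a \<noteq> b" "a \<noteq> c" "b \<noteq> c"
      by (rule related_triple[OF S])
    moreover have "\<not> holds S axB" using that(1) B by simp
    ultimately show ?thesis by (elim not_axB_triple[OF S]) (rule four_le_struct_card)
  qed
  have four': "enat 4 \<le> struct_card S" if "ax9 \<in> X"
  proof -
    have "\<not> holds S ax9" using that N by simp
    then obtain a b c x where "a \<in> Dom S" "b \<in> Dom S" "c \<in> Dom S" "x \<in> Dom S"
      "a \<noteq> b" "a \<noteq> c" "b \<noteq> c" "a \<noteq> x" "b \<noteq> x" "c \<noteq> x"
      unfolding holds_ax9[OF S] by blast
    then show ?thesis
      using card_le_struct_card[of "{a, b, c, x}" S 4] by simp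
  qed
  show ?thesis using one two three four four'
    by (simp add: bound_def)
qed

section \<open>Finite models\<close>

text \<open>The arguments say which of \<open>axB\<close>, \<open>axC\<close>, \<open>ax9\<close> are to be false.
  Every value is a nonempty list without reversed triples,
  so \<open>axA\<close> is false unless the list is closed under reversal. Only the triples
  that fit into the intended number of points are used: this empties the first list on at most
  two points, where \<open>axB\<close> is vacuous, and the fifth list on three points, where emptiness
  falsifies \<open>axB\<close>. For \<open>axC\<close> to be false, \<open>(0,1,2)\<close> is accompanied by
  \<open>(0,2,1)\<close>; for \<open>ax9\<close> to be false while \<open>axB\<close> is true,
  \<open>(1,3,2)\<close> takes the place of \<open>(1,2,3)\<close> in the linear order \<open>0,1,2,3\<close>, where
  it meets the point \<open>0\<close> without \<open>(1,3,0)\<close> or \<open>(0,3,2)\<close>; while \<open>axB\<close> is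
  false too, triples that avoid the point \<open>3\<close> altogether do the same.\<close>

fun triples :: "bool \<Rightarrow> bool \<Rightarrow> bool \<Rightarrow> (nat \<times> nat \<times> nat) list" where
  "triples False False False = [(0, 1, 2)]"
| "triples False False True = [(0, 1, 2), (0, 1, 3), (0, 2, 3), (1, 3, 2)]"
| "triples False True False = [(0, 1, 2), (0, 2, 1)]"
| "triples False True True = [(0, 1, 2), (0, 1, 3), (0, 2, 1), (0, 2, 3), (1, 3, 2)]"
| "triples True False False = [(3, 0, 1), (3, 0, 2)]"
| "triples True False True = [(0, 1, 2)]"
| "triples True True False = [(0, 1, 2), (0, 1, 3), (0, 2, 1), (0, 2, 3)]"
| "triples True True True = [(0, 1, 2), (0, 2, 1)]"

text \<open>If \<open>axA\<close> and \<open>axD\<close> are both false, the reversed triples stay in and \<open>(0,0,1)\<close>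
  alone violates both axioms; this is why \<open>bound\<close> may drop when \<open>axD\<close> becomes false.\<close>

definition model :: "bool \<Rightarrow> bool \<Rightarrow> bool \<Rightarrow> bool \<Rightarrow> bool \<Rightarrow> nat struct" where
  "model fA fB fC fD f9 =
    (let n = bound fA fB fC fD f9;
         ts = filter (\<lambda>(x, y, z). x < n \<and> y < n \<and> z < n) (triples fB fC f9)
     in \<lparr>Dom = {0..<n},
         Rel = set (ts
           @ (if fA \<and> \<not> fD then [] else map (\<lambda>(x, y, z). (z, y, x)) ts)
           @ (if fD then [if fA then (0, 0, 1) else (0, 0, 0)] else []))\<rparr>)"

lemma Dom_model: "Dom (model fA fB fC fD f9) = {0..<bound fA fB fC fD f9}"
  by (simp add: model_def Let_def)

lemma is_struct_model: "is_struct (model fA fB fC fD f9)"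
  by (auto simp: is_struct_def model_def Let_def bound_def split: if_splits)

lemma initial_segments:
  "{0..<2} = {0, 1 :: nat}" "{0..<3} = {0, 1, 2 :: nat}" "{0..<4} = {0, 1, 2, 3 :: nat}"
  by auto

lemma model_correct:
  "holds (model fA fB fC fD f9) axA \<longleftrightarrow> \<not> fA"
  "holds (model fA fB fC fD f9) axB \<longleftrightarrow> \<not> fB"
  "holds (model fA fB fC fD f9) axC \<longleftrightarrow> \<not> fC"
  "holds (model fA fB fC fD f9) axD \<longleftrightarrow> \<not> fD"
  "holds (model fA fB fC fD f9) ax9 \<longleftrightarrow> \<not> f9"
  unfolding holds_axioms[OF is_struct_model]
  by (cases fA; cases fB; cases fC; cases fD; cases f9;
      simp add: model_def bound_def initial_segments)+

lemma realizer_exists: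
  assumes "X \<subseteq> Huntington"
  shows "\<exists>S :: 'a::infinite struct. realizes S X \<and> struct_card S = enat (bound_of X)"
proof -
  obtain f :: "nat \<Rightarrow> 'a" where f: "inj f"
    using infinite_countable_subset[OF infinite_UNIV] by blast
  let ?M = "model (axA \<in> X) (axB \<in> X) (axC \<in> X) (axD \<in> X) (ax9 \<in> X)"
  have "realizes (copy f ?M) X"
    unfolding realizes_iff[OF assms] holds_copy[OF f] model_correct
    by (simp add: is_struct_copy is_struct_model)
  moreover have "struct_card (copy f ?M) = enat (bound_of X)"
    unfolding struct_card_copy[OF f] by (simp add: struct_card_def Dom_model)
  ultimately show ?thesis by blast
qed

section \<open>Minimal cardinalities and complete independence\<close>

lemma min_card_eq_bound:
  fixes ty :: "'a::infinite itself"
  assumes "X \<subseteq> Huntington"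
  shows "min_card ty X = enat (bound_of X)"
proof (rule antisym)
  obtain S :: "'a struct" where "realizes S X" "struct_card S = enat (bound_of X)"
    using realizer_exists[OF assms] by blast
  then show "min_card ty X \<le> enat (bound_of X)"
    unfolding min_card_def by (metis INF_lower mem_Collect_eq)
  show "enat (bound_of X) \<le> min_card ty X"
    unfolding min_card_def by (rule INF_greatest) (use bound_le_struct_card assms in blast)
qed

lemma completely_independent_Huntington:
  "completely_independent (ty :: 'a::infinite itself) Huntington"
  unfolding completely_independent_def
proof (intro conjI ballI allI impI)
  fix X assume X: "X \<subseteq> Huntington"
  obtain S :: "'a struct" where S: "realizes S X" using realizer_exists[OF X] by blast
  then have "holds S (Neg p)" if "p \<in> X" for p
    using that X holds_Neg_iff sentence_Huntington unfolding realizes_def by blast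
  with S show "satisfiable ty ((Huntington - X) \<union> Neg ` X)"
    unfolding satisfiable_def realizes_def by blast
qed (rule sentence_Huntington)

lemma card_Huntington: "card Huntington = 5"
  by (simp add: Huntington_def)

definition small_sets :: "form set set" where
  "small_sets = {{}, {axD}, {axC}, {axC, axD}, {axB}, {axB, axD}, {axA}, {axA, axD},
     {axA, axC}, {axA, axC, axD}, {axA, axB, axD}}"

lemma small_sets_subset: "small_sets \<subseteq> Pow Huntington"
  by (simp add: small_sets_def Huntington_def)

lemma bound_less_4_iff:
  assumes "X \<subseteq> Huntington"
  shows "bound_of X < 4 \<longleftrightarrow> X \<in> small_sets"
proof
  have X: "X = set (filter (\<lambda>p. p \<in> X) [axA, axB, axC, axD, ax9])"
    using assms by (auto simp: Huntington_def)
  assume "bound_of X < 4"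
  then show "X \<in> small_sets" unfolding small_sets_def
    by (subst X; cases "axA \<in> X"; cases "axB \<in> X"; cases "axC \<in> X"; cases "axD \<in> X";
        cases "ax9 \<in> X"; simp add: bound_def)
next
  assume "X \<in> small_sets"
  then show "bound_of X < 4" unfolding small_sets_def
    by (elim insertE emptyE) (simp_all add: bound_def)
qed

text \<open>Membership vectors turn distinctness of sets of formulas into distinctness of
  tuples of truth values.\<close>

lemma card_small_sets: "card small_sets = 11"
proof -
  let ?g = "\<lambda>X. (axA \<in> X, axB \<in> X, axC \<in> X, axD \<in> X, ax9 \<in> X)"
  have inj: "inj_on ?g (Pow Huntington)"
    by (rule inj_onI) (auto simp: Huntington_def)
  have "card small_sets = card (?g ` small_sets)"
    by (rule card_image[OF inj_on_subset[OF inj small_sets_subset], symmetric])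
  also have "\<dots> = 11" unfolding small_sets_def image_insert image_empty by simp
  finally show ?thesis .
qed

theorem mainTheorem1:
  fixes ty :: "'a::infinite itself"
  shows
   "let m = min_card ty;
        Small = {{}, {axD}, {axC}, {axC, axD}, {axB}, {axB, axD}, {axA}, {axA, axD},
                 {axA, axC}, {axA, axC, axD}, {axA, axB, axD}}
    in card (Pow Huntington) = 32 \<and>
       (\<forall>X \<subseteq> Huntington. \<exists>S :: 'a struct. realizes S X) \<and>
       completely_independent ty Huntington \<and>
       (\<forall>X \<subseteq> Huntington. m X \<le> 4) \<and>
       {X. X \<subseteq> Huntington \<and> m X < 4} = Small \<and>
       card Small = 11 \<and>
       m {} = 1 \<and>
       m {axD} = 1 \<and>
       m {axC} = 3 \<and>
       m {axC, axD} = 3 \<and>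
       m {axB} = 3 \<and>
       m {axB, axD} = 3 \<and>
       m {axA} = 3 \<and>
       m {axA, axD} = 2 \<and>
       m {axA, axC} = 3 \<and>
       m {axA, axC, axD} = 3 \<and>
       m {axA, axB, axD} = 3 \<and>
       (\<forall>X \<in> Pow Huntington - Small. m X = 4) \<and>
       card (Pow Huntington - Small) = 21"
proof -
  let ?m = "min_card ty"
  have m: "?m X = enat (bound_of X)" if "X \<subseteq> Huntington" for X
    using that by (rule min_card_eq_bound)
  have le4: "?m X \<le> 4" if "X \<subseteq> Huntington" for X
    using m[OF that] by (simp add: bound_def numeral_eq_enat)
  have lt4: "?m X < 4 \<longleftrightarrow> X \<in> small_sets" if "X \<subseteq> Huntington" for X
    using m[OF that] bound_less_4_iff[OF that] by (simp only: numeral_eq_enat enat_ord_simps)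
  have small: "{X. X \<subseteq> Huntington \<and> ?m X < 4} = small_sets"
    using lt4 small_sets_subset by blast
  have rest: "\<forall>X \<in> Pow Huntington - small_sets. ?m X = 4"
  proof
    fix X assume "X \<in> Pow Huntington - small_sets"
    then have "X \<subseteq> Huntington" "\<not> ?m X < 4" using lt4[of X] by simp_all
    then show "?m X = 4" using le4[of X] by (simp add: not_less)
  qed
  have card32: "card (Pow Huntington) = 32"
    using card_Pow[of Huntington] card_Huntington by (simp add: card_ge_0_finite)
  have "finite small_sets" by (simp add: small_sets_def)
  then have card21: "card (Pow Huntington - small_sets) = 21"
    using card_Diff_subset[OF _ small_sets_subset] card32 card_small_sets by simp
  have vals: "?m {} = 1" "?m {axD} = 1" "?m {axC} = 3" "?m {axC, axD} = 3" "?m {axB} = 3"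
    "?m {axB, axD} = 3" "?m {axA} = 3" "?m {axA, axD} = 2" "?m {axA, axC} = 3"
    "?m {axA, axC, axD} = 3" "?m {axA, axB, axD} = 3"
    by (subst m; simp add: Huntington_def bound_def numeral_eq_enat one_enat_def)+
  have ex: "\<forall>X \<subseteq> Huntington. \<exists>S :: 'a struct. realizes S X"
    using realizer_exists by blast
  show ?thesis
    unfolding Let_def small_sets_def[symmetric]
    by (intro conjI card32 ex completely_independent_Huntington allI impI le4 small
        card_small_sets vals rest card21)
qed

end
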